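(* Let $R$ be a fully idempotent semihyperring. Let $FI_R$ be the lattice of fuzzy hyperideals of $R$ (ordered by $\leq$) and let $FP_R$ be the set of all proper fuzzy prime hyperideals of $R$. For $\lambda\in FI_R$ put $O_\lambda=\{\mu\in FP_R:\lambda\nleq\mu\}$, and let $\tau(FP_R)=\{O_\lambda:\lambda\in FI_R\}$. Then $\tau(FP_R)$ is a topology on the set $FP_R$, and the assignment $\lambda\mapsto O_\lambda$ is an isomorphism between the lattice $FI_R$ of fuzzy hyperideals of $R$ and the lattice of open subsets of $FP_R$.
   Context: A commutative semihypergroup is a non-empty set $R$ with a map $\oplus$ from $R\times R$ to the non-empty subsets of $R$ which is commutative and associative, where $A\oplus B=\bigcup_{a\in A,b\in B}a\oplus b$ for subsets and an element is identified with its singleton when convenient. A semihyperring $(R,\oplus,\cdot)$ is a non-empty set $R$ such that $(R,\oplus)$ is a commutative semihypergroup, $(R,\cdot)$ is a semigroup, $x(y\oplus z)=xy\oplus xz$ and $(x\oplus y)z=xz\oplus yz$ for all $x,y,z\in R$ (equality of sets), and there is an element $0\in R$ with $0\oplus x=x\oplus 0=\{x\}$ and $0x=x0=0$ for all $x\in R$. No multiplicative identity is assumed. A hyperideal of $R$ is a non-empty subset $I\subseteq R$ with $x\oplus y\subseteq I$ for $x,y\in I$ and $rx,xr\in I$ for $r\in R$, $x\in I$. For hyperideals $I,J$, the product $IJ$ is the set of all elements lying in some finite hypersum $a_1b_1\oplus\cdots\oplus a_pb_p$ with $a_i\in I$, $b_i\in J$, $p\ge 1$. $R$ is fully idempotent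 if $I^2=I$ for every hyperideal $I$ of $R$. A fuzzy subset of $R$ is a function $\mu:R\to[0,1]$. $\lambda\leq\mu$ means $\lambda(x)\leq\mu(x)$ for all $x$. $\wedge$ and $\vee$ denote (pointwise) infimum and supremum; the supremum of the empty set is $0$. A fuzzy hyperideal of $R$ is a fuzzy subset $\mu$ with $\mu(0)=1$, $\inf_{z\in x\oplus y}\mu(z)\geq\mu(x)\wedge\mu(y)$, $\mu(xy)\geq\mu(x)$ and $\mu(yx)\geq\mu(x)$ for all $x,y\in R$. It is proper if it is not the constant function $1$. For fuzzy hyperideals $\lambda,\mu$, the sum and product are $$(\lambda\oplus\mu)(x)=\bigvee_{x\in y\oplus z}[\lambda(y)\wedge\mu(z)],\qquad (\lambda\mu)(x)=\bigvee_{x\in y_1z_1\oplus\cdots\oplus y_pz_p}\ \bigwedge_{1\le i\le p}[\lambda(y_i)\wedge\mu(z_i)],$$ the second supremum being over all $p\ge 1$ and all $y_i,z_i\in R$ with $x\in y_1z_1\oplus\cdots\oplus y_pz_p$. The lattice operations of $FI_R$ are the sum $\oplus$ (join) and the pointwise minimum $\wedge$ (meet). A fuzzy hyperideal $\eta$ is fuzzy prime if for all fuzzy hyperideals $\lambda,\mu$ of $R$, $\lambda\mu\leq\eta$ implies $\lambda\leq\eta$ or $\mu\leq\eta$. *)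

theory Defs
  imports Complex_Main "HOL-Algebra.Lattice" "HOL-Analysis.Abstract_Topology"
begin

definition set_hadd :: "('a \<Rightarrow> 'a \<Rightarrow> 'a set) \<Rightarrow> 'a set \<Rightarrow> 'a set \<Rightarrow> 'a set" where
  "set_hadd h A B = (\<Union>a\<in>A. \<Union>b\<in>B. h a b)"

text \<open>The underlying non-empty set is the whole type \<open>'a\<close>.\<close>

locale comm_semihypergroup =
  fixes hadd :: "'a \<Rightarrow> 'a \<Rightarrow> 'a set"
  assumes hadd_nonempty: "hadd x y \<noteq> {}"
    and hadd_commute: "hadd x y = hadd y x"
    and hadd_assoc: "set_hadd hadd (hadd x y) {z} = set_hadd hadd {x} (hadd y z)"

locale semihyperring = comm_semihypergroup hadd + semigroup mult
  for hadd :: "'a \<Rightarrow> 'a \<Rightarrow> 'a set" and mult :: "'a \<Rightarrow> 'a \<Rightarrow> 'a" +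
  fixes zero :: 'a
  assumes distrib_left: "mult x ` hadd y z = hadd (mult x y) (mult x z)"
    and distrib_right: "(\<lambda>w. mult w z) ` hadd x y = hadd (mult x z) (mult y z)"
    and hadd_zero_left: "hadd zero x = {x}"
    and hadd_zero_right: "hadd x zero = {x}"
    and mult_zero_left: "mult zero x = zero"
    and mult_zero_right: "mult x zero = zero"

text \<open>The supremum in \<open>[0,1]\<close>: the supremum of the empty set is \<open>0\<close>, whereas \<open>Sup {}\<close> is
  unspecified on the reals.\<close>

definition fuzzy_Sup :: "real set \<Rightarrow> real" where
  "fuzzy_Sup S = (if S = {} then 0 else Sup S)"

definition fuzzy_subset :: "('a \<Rightarrow> real) \<Rightarrow> bool" where
  "fuzzy_subset \<mu> \<longleftrightarrow> (\<forall>x. \<mu> x \<in> {0..1})"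

context semihyperring
begin

text \<open>The finite hypersum of a list. Starting from \<open>{zero}\<close> is harmless for non-empty lists
  because \<open>hadd a zero = {a}\<close>; below only non-empty lists are used.\<close>

definition hypersum :: "'a list \<Rightarrow> 'a set" where
  "hypersum as = foldr (\<lambda>a S. set_hadd hadd {a} S) as {zero}"

definition hyperideal :: "'a set \<Rightarrow> bool" where
  "hyperideal I \<longleftrightarrow> I \<noteq> {} \<and> (\<forall>x\<in>I. \<forall>y\<in>I. hadd x y \<subseteq> I) \<and>
     (\<forall>r. \<forall>x\<in>I. mult r x \<in> I \<and> mult x r \<in> I)"

definition hyperideal_prod :: "'a set \<Rightarrow> 'a set \<Rightarrow> 'a set" where
  "hyperideal_prod I J =
     {x. \<exists>ps. ps \<noteq> [] \<and> set ps \<subseteq> I \<times> J \<and> x \<in> hypersum (map (\<lambda>(a, b). mult a b) ps)}"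

definition fully_idempotent :: bool where
  "fully_idempotent \<longleftrightarrow> (\<forall>I. hyperideal I \<longrightarrow> hyperideal_prod I I = I)"

definition fuzzy_hyperideal :: "('a \<Rightarrow> real) \<Rightarrow> bool" where
  "fuzzy_hyperideal \<mu> \<longleftrightarrow> fuzzy_subset \<mu> \<and> \<mu> zero = 1 \<and>
     (\<forall>x y. (INF z\<in>hadd x y. \<mu> z) \<ge> min (\<mu> x) (\<mu> y)) \<and>
     (\<forall>x y. \<mu> (mult x y) \<ge> \<mu> x \<and> \<mu> (mult y x) \<ge> \<mu> x)"

definition fuzzy_sum :: "('a \<Rightarrow> real) \<Rightarrow> ('a \<Rightarrow> real) \<Rightarrow> 'a \<Rightarrow> real" where
  "fuzzy_sum \<kappa> \<mu> x = fuzzy_Sup {min (\<kappa> y) (\<mu> z) |y z. x \<in> hadd y z}"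

definition fuzzy_prod :: "('a \<Rightarrow> real) \<Rightarrow> ('a \<Rightarrow> real) \<Rightarrow> 'a \<Rightarrow> real" where
  "fuzzy_prod \<kappa> \<mu> x =
     fuzzy_Sup {Min ((\<lambda>(y, z). min (\<kappa> y) (\<mu> z)) ` set ps) |ps.
       ps \<noteq> [] \<and> x \<in> hypersum (map (\<lambda>(y, z). mult y z) ps)}"

definition fuzzy_prime :: "('a \<Rightarrow> real) \<Rightarrow> bool" where
  "fuzzy_prime \<eta> \<longleftrightarrow> fuzzy_hyperideal \<eta> \<and>
     (\<forall>\<kappa> \<mu>. fuzzy_hyperideal \<kappa> \<longrightarrow> fuzzy_hyperideal \<mu> \<longrightarrow>
        fuzzy_prod \<kappa> \<mu> \<le> \<eta> \<longrightarrow> \<kappa> \<le> \<eta> \<or> \<mu> \<le> \<eta>)"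

definition FI :: "('a \<Rightarrow> real) set" where
  "FI = {\<mu>. fuzzy_hyperideal \<mu>}"

definition FP :: "('a \<Rightarrow> real) set" where
  "FP = {\<eta>. fuzzy_prime \<eta> \<and> \<eta> \<noteq> (\<lambda>x. 1)}"

definition FP_open :: "('a \<Rightarrow> real) \<Rightarrow> ('a \<Rightarrow> real) set" where
  "FP_open \<kappa> = {\<mu> \<in> FP. \<not> \<kappa> \<le> \<mu>}"

definition FP_opens :: "('a \<Rightarrow> real) set set" where
  "FP_opens = FP_open ` FI"

definition FI_lattice :: "('a \<Rightarrow> real) gorder" where
  "FI_lattice = \<lparr>carrier = FI, eq = (=), le = (\<le>)\<rparr>"

end

definition opens_lattice :: "'b topology \<Rightarrow> 'b set gorder" where
  "opens_lattice X = \<lparr>carrier = {U. openin X U}, eq = (=), le = (\<subseteq>)\<rparr>"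

definition lattice_iso :: "('b \<Rightarrow> 'c) \<Rightarrow> 'b gorder \<Rightarrow> 'c gorder \<Rightarrow> bool" where
  "lattice_iso f L M \<longleftrightarrow> lattice L \<and> lattice M \<and> bij_betw f (carrier L) (carrier M) \<and>
     (\<forall>x\<in>carrier L. \<forall>y\<in>carrier L.
        f (join L x y) = join M (f x) (f y) \<and> f (meet L x y) = meet M (f x) (f y))"

end

theory Submission
  imports Defs
begin

text \<open>
  Everything rests on two facts about a fully idempotent semihyperring.

  The first is that the product of fuzzy hyperideals is their pointwise minimum
  (\<open>fuzzy_prod_eq_inf\<close>): for \<open>t = \<kappa> x \<and> \<mu> x\<close>, the element \<open>x\<close> lies in the hyperideal
  \<open>I = {\<kappa> \<ge> t} \<inter> {\<mu> \<ge> t}\<close>, and \<open>I = I I\<close> writes \<open>x\<close> as a member of a hypersum of products of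
  elements of \<open>I\<close>. So a fuzzy prime is the same as a prime element for the meet, which is what makes
  \<open>\<kappa> \<mapsto> O_\<kappa>\<close> turn meets into intersections. Since \<open>O_\<kappa>\<close> is defined by \<open>\<kappa> \<not>\<le> \<mu>\<close>, it turns least upper
  bounds into unions. As \<open>FI\<close> is closed under arbitrary infima, least
  upper bounds of arbitrary families exist, and the sets \<open>O_\<kappa>\<close> form a topology.

  The second is that every fuzzy hyperideal is the infimum of the proper fuzzy primes above it
  (\<open>fuzzy_prime_separation\<close>), which gives injectivity. Suppose \<open>\<alpha> = \<kappa> x < 1\<close>. By Zorn's lemma the
  hyperideal \<open>{\<kappa> > \<alpha>}\<close> extends to a hyperideal \<open>P\<close> that is maximal among those
  avoiding \<open>x\<close>. The fuzzy set with value \<open>1\<close> on \<open>P\<close> and \<open>\<alpha>\<close> elsewhere then lies above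
  \<open>\<kappa>\<close>, agrees with it at \<open>x\<close>, and is fuzzy prime because \<open>P\<close> is prime: if \<open>P\<close> contained
  \<open>A \<inter> B\<close> but neither \<open>A\<close> nor \<open>B\<close>, maximality would put \<open>x\<close> in \<open>(P \<oplus> A) \<inter> (P \<oplus> B)\<close>; this
  hyperideal is its own square, so it is contained in \<open>(P \<oplus> A)(P \<oplus> B)\<close>, hence in \<open>P\<close>.
\<close>

section \<open>Lattices carried by subsets of an ordered type\<close>

text \<open>Both lattices in question are sets of elements of an ordered type, so their abstract joins and
  meets can be computed by exhibiting least upper and greatest lower bounds inside the set. These
  bounds need not be those of the ambient type: the join of two fuzzy hyperideals is their fuzzy
  sum, in general not their pointwise maximum.\<close>

lemma order_gorder_lattice:
  fixes C :: "'b::order set"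
  defines "G \<equiv> \<lparr>carrier = C, eq = (=), le = (\<le>)\<rparr>"
  assumes s: "\<And>x y. x \<in> C \<Longrightarrow> y \<in> C \<Longrightarrow> s x y \<in> C \<and> x \<le> s x y \<and> y \<le> s x y"
    and s_least: "\<And>x y z. x \<in> C \<Longrightarrow> y \<in> C \<Longrightarrow> z \<in> C \<Longrightarrow> x \<le> z \<Longrightarrow> y \<le> z \<Longrightarrow> s x y \<le> z"
    and i: "\<And>x y. x \<in> C \<Longrightarrow> y \<in> C \<Longrightarrow> i x y \<in> C \<and> i x y \<le> x \<and> i x y \<le> y"
    and i_greatest: "\<And>x y z. x \<in> C \<Longrightarrow> y \<in> C \<Longrightarrow> z \<in> C \<Longrightarrow> z \<le> x \<Longrightarrow> z \<le> y \<Longrightarrow> z \<le> i x y"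
  shows "lattice G"
    and "x \<in> C \<Longrightarrow> y \<in> C \<Longrightarrow> join G x y = s x y"
    and "x \<in> C \<Longrightarrow> y \<in> C \<Longrightarrow> meet G x y = i x y"
proof -
  interpret partial_order G
    by unfold_locales (auto simp: G_def)
  have lub: "least G (s x y) (Upper G {x, y})" if "x \<in> C" "y \<in> C" for x y
    using that s s_least by (auto simp: least_def Upper_def G_def)
  have glb: "greatest G (i x y) (Lower G {x, y})" if "x \<in> C" "y \<in> C" for x y
    using that i i_greatest by (auto simp: greatest_def Lower_def G_def)
  have carr: "carrier G = C" by (simp add: G_def)
  interpret lattice G
    by unfold_locales (use lub glb carr in blast)+
  show "lattice G" ..
  show "join G x y = s x y" if "x \<in> C" "y \<in> C"
  proof -
    have "least G (join G x y) (Upper G {x, y})"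
      unfolding join_def using sup_of_two_least that carr by simp
    from this lub[OF that] show ?thesis by (rule least_unique)
  qed
  show "meet G x y = i x y" if "x \<in> C" "y \<in> C"
  proof -
    have "greatest G (meet G x y) (Lower G {x, y})"
      unfolding meet_def using inf_of_two_greatest that carr by simp
    from this glb[OF that] show ?thesis by (rule greatest_unique)
  qed
qed

lemma opens_lattice_operations:
  shows "lattice (opens_lattice X)"
    and "openin X U \<Longrightarrow> openin X V \<Longrightarrow> join (opens_lattice X) U V = U \<union> V"
    and "openin X U \<Longrightarrow> openin X V \<Longrightarrow> meet (opens_lattice X) U V = U \<inter> V"
  unfolding opens_lattice_def
  by (rule order_gorder_lattice[where s = "(\<union>)" and i = "(\<inter>)"]; auto)+

section \<open>Fuzzy suprema\<close>

lemma fuzzy_Sup_least: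
  assumes "\<And>v. v \<in> S \<Longrightarrow> v \<le> b" "0 \<le> b"
  shows "fuzzy_Sup S \<le> b"
  using assms by (auto simp: fuzzy_Sup_def intro: cSup_least)

lemma fuzzy_Sup_upper:
  assumes "v \<in> S" "\<And>w. w \<in> S \<Longrightarrow> w \<le> (1::real)"
  shows "v \<le> fuzzy_Sup S"
proof -
  have "bdd_above S" using assms(2) by (rule bdd_aboveI)
  with assms(1) show ?thesis by (auto simp: fuzzy_Sup_def intro: cSup_upper)
qed

text \<open>Inequalities of the form \<open>\<mu> x \<and> \<mu> y \<le> \<mu> w\<close> for fuzzy sets defined by suprema reduce to
  combining one witness for \<open>x\<close> with one for \<open>y\<close>, because \<open>[0,1]\<close> is a chain.\<close>

lemma min_fuzzy_Sup_le:
  assumes "S \<noteq> {}" "T \<noteq> {}"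
    and "\<And>v w. v \<in> S \<Longrightarrow> w \<in> T \<Longrightarrow> min v w \<le> b"
  shows "min (fuzzy_Sup S) (fuzzy_Sup T) \<le> b"
proof (rule ccontr)
  assume "\<not> ?thesis"
  hence "b < Sup S" "b < Sup T" using assms(1,2) by (auto simp: fuzzy_Sup_def)
  then obtain v w where "v \<in> S" "b < v" "w \<in> T" "b < w"
    using less_cSupD[OF assms(1)] less_cSupD[OF assms(2)] by metis
  with assms(3)[of v w] show False by auto
qed

context semihyperring
begin

section \<open>Hyperideals\<close>

lemma set_hadd_assoc:
  "set_hadd hadd (set_hadd hadd A B) C = set_hadd hadd A (set_hadd hadd B C)"
proof -
  have *: "(\<Union>w\<in>hadd a b. hadd w c) = (\<Union>w\<in>hadd b c. hadd a w)" for a b c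
    using hadd_assoc[of a b c] by (simp add: set_hadd_def)
  have "set_hadd hadd (set_hadd hadd A B) C = (\<Union>a\<in>A. \<Union>b\<in>B. \<Union>c\<in>C. \<Union>w\<in>hadd a b. hadd w c)"
    unfolding set_hadd_def by blast
  also have "\<dots> = set_hadd hadd A (set_hadd hadd B C)"
    unfolding * unfolding set_hadd_def by blast
  finally show ?thesis .
qed

lemma set_hadd_commute: "set_hadd hadd A B = set_hadd hadd B A"
  unfolding set_hadd_def using hadd_commute by blast

text \<open>This rearrangement is what makes sums of hyperideals, crisp or fuzzy, closed under the
  hyperaddition.\<close>

lemma hadd_interchange:
  assumes "x \<in> hadd a b" "y \<in> hadd c d" "w \<in> hadd x y"
  obtains u v where "u \<in> hadd a c" "v \<in> hadd b d" "w \<in> hadd u v"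
proof -
  have "w \<in> set_hadd hadd (set_hadd hadd {a} {b}) (set_hadd hadd {c} {d})"
    using assms by (auto simp: set_hadd_def)
  also have "\<dots> = set_hadd hadd (set_hadd hadd {a} {c}) (set_hadd hadd {b} {d})"
    by (metis set_hadd_assoc set_hadd_commute)
  finally show thesis using that by (auto simp: set_hadd_def)
qed

lemma mult_hadd_left: "y \<in> hadd a b \<Longrightarrow> mult r y \<in> hadd (mult r a) (mult r b)"
  using distrib_left[of r a b] by blast

lemma mult_hadd_right: "y \<in> hadd a b \<Longrightarrow> mult y r \<in> hadd (mult a r) (mult b r)"
  using distrib_right[of r a b] by blast

lemma hyperidealD:
  assumes "hyperideal I"
  shows "x \<in> I \<Longrightarrow> y \<in> I \<Longrightarrow> z \<in> hadd x y \<Longrightarrow> z \<in> I"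
    and "x \<in> I \<Longrightarrow> mult r x \<in> I"
    and "x \<in> I \<Longrightarrow> mult x r \<in> I"
  using assms by (auto simp: hyperideal_def)

lemma zero_in_hyperideal: "hyperideal I \<Longrightarrow> zero \<in> I"
  unfolding hyperideal_def by (metis equals0I mult_zero_left)

lemma hyperideal_Int:
  assumes "hyperideal I" "hyperideal J"
  shows "hyperideal (I \<inter> J)"
proof -
  have "zero \<in> I \<inter> J" using assms zero_in_hyperideal by blast
  thus ?thesis using assms unfolding hyperideal_def by blast
qed

lemma hyperideal_set_hadd:
  assumes "hyperideal I" "hyperideal J"
  shows "hyperideal (set_hadd hadd I J)"
  unfolding hyperideal_def
proof (intro conjI ballI allI subsetI)
  show "set_hadd hadd I J \<noteq> {}"
    using zero_in_hyperideal[OF assms(1)] zero_in_hyperideal[OF assms(2)] hadd_nonempty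
    by (auto simp: set_hadd_def)
next
  fix x y w assume xy: "x \<in> set_hadd hadd I J" "y \<in> set_hadd hadd I J" and w: "w \<in> hadd x y"
  from xy obtain a b c d
    where abcd: "a \<in> I" "b \<in> J" "c \<in> I" "d \<in> J" and "x \<in> hadd a b" "y \<in> hadd c d"
    by (auto simp: set_hadd_def)
  with w obtain u v where uv: "u \<in> hadd a c" "v \<in> hadd b d" "w \<in> hadd u v"
    using hadd_interchange by blast
  have "u \<in> I" "v \<in> J"
    using hyperidealD(1)[OF assms(1) abcd(1,3) uv(1)] hyperidealD(1)[OF assms(2) abcd(2,4) uv(2)] .
  with uv(3) show "w \<in> set_hadd hadd I J" by (auto simp: set_hadd_def)
next
  fix r x assume "x \<in> set_hadd hadd I J"
  then obtain a b where ab: "a \<in> I" "b \<in> J" "x \<in> hadd a b"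
    by (auto simp: set_hadd_def)
  show "mult r x \<in> set_hadd hadd I J"
    using mult_hadd_left[OF ab(3), of r] ab(1,2) assms hyperidealD(2)
    unfolding set_hadd_def by blast
  show "mult x r \<in> set_hadd hadd I J"
    using mult_hadd_right[OF ab(3), of r] ab(1,2) assms hyperidealD(3)
    unfolding set_hadd_def by blast
qed

lemma set_hadd_upper:
  assumes "hyperideal I" "hyperideal J"
  shows "I \<subseteq> set_hadd hadd I J" "J \<subseteq> set_hadd hadd I J"
proof -
  have "x \<in> set_hadd hadd I J" if "x \<in> I" for x
    using that zero_in_hyperideal[OF assms(2)] hadd_zero_right[of x] by (auto simp: set_hadd_def)
  thus "I \<subseteq> set_hadd hadd I J" by blast
  have "x \<in> set_hadd hadd I J" if "x \<in> J" for x
    using that zero_in_hyperideal[OF assms(1)] hadd_zero_left[of x] by (auto simp: set_hadd_def)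
  thus "J \<subseteq> set_hadd hadd I J" by blast
qed

lemma hypersum_subset_hyperideal:
  assumes "hyperideal I" "set as \<subseteq> I"
  shows "hypersum as \<subseteq> I"
  using assms(2)
proof (induction as)
  case Nil
  thus ?case using zero_in_hyperideal[OF assms(1)] by (simp add: hypersum_def)
next
  case (Cons a as)
  have "hypersum (a # as) = (\<Union>s\<in>hypersum as. hadd a s)"
    by (simp add: hypersum_def set_hadd_def)
  with Cons show ?case using hyperidealD(1)[OF assms(1), of a] by auto
qed

section \<open>Maximal hyperideals avoiding an element\<close>

lemma hyperideal_Union_chain:
  assumes "\<C> \<noteq> {}" "\<And>I. I \<in> \<C> \<Longrightarrow> hyperideal I"
    and chain: "\<And>I J. I \<in> \<C> \<Longrightarrow> J \<in> \<C> \<Longrightarrow> I \<subseteq> J \<or> J \<subseteq> I"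
  shows "hyperideal (\<Union>\<C>)"
  unfolding hyperideal_def
proof (intro conjI ballI allI subsetI)
  show "\<Union>\<C> \<noteq> {}"
    using assms(1,2) zero_in_hyperideal by blast
next
  fix x y w assume "x \<in> \<Union>\<C>" "y \<in> \<Union>\<C>" and w: "w \<in> hadd x y"
  then obtain I J where IJ: "I \<in> \<C>" "x \<in> I" "J \<in> \<C>" "y \<in> J" by blast
  with chain[of I J] obtain K where "K \<in> \<C>" "x \<in> K" "y \<in> K" by blast
  thus "w \<in> \<Union>\<C>" using assms(2) hyperidealD(1) w by blast
next
  fix r x assume "x \<in> \<Union>\<C>"
  then obtain I where I: "I \<in> \<C>" "x \<in> I" by blast
  show "mult r x \<in> \<Union>\<C>" "mult x r \<in> \<Union>\<C>"
    using I hyperidealD(2,3)[OF assms(2)[OF I(1)] I(2)] by blast+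
qed

lemma exists_maximal_hyperideal_avoiding:
  assumes "hyperideal J" "x \<notin> J"
  obtains P where "hyperideal P" "J \<subseteq> P" "x \<notin> P"
    "\<And>Q. hyperideal Q \<Longrightarrow> P \<subseteq> Q \<Longrightarrow> x \<notin> Q \<Longrightarrow> Q = P"
proof -
  let ?A = "{I. hyperideal I \<and> J \<subseteq> I \<and> x \<notin> I}"
  have "\<exists>M\<in>?A. \<forall>X\<in>?A. M \<subseteq> X \<longrightarrow> X = M"
  proof (rule subset_Zorn_nonempty)
    show "?A \<noteq> {}" using assms by auto
    fix \<C> assume ne: "\<C> \<noteq> {}" and "subset.chain ?A \<C>"
    hence sub: "\<C> \<subseteq> ?A" and chain: "\<And>I K. I \<in> \<C> \<Longrightarrow> K \<in> \<C> \<Longrightarrow> I \<subseteq> K \<or> K \<subseteq> I"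
      by (auto simp: subset_chain_def)
    have "hyperideal (\<Union>\<C>)"
      by (rule hyperideal_Union_chain[OF ne _ chain]) (use sub in auto)
    thus "\<Union>\<C> \<in> ?A" using ne sub by auto
  qed
  then obtain P where P: "P \<in> ?A" and max: "\<forall>X\<in>?A. P \<subseteq> X \<longrightarrow> X = P" by (rule bexE)
  show thesis
  proof (rule that[of P])
    fix Q assume "hyperideal Q" "P \<subseteq> Q" "x \<notin> Q"
    moreover from this P have "Q \<in> ?A" by auto
    ultimately show "Q = P" using max by simp
  qed (use P in auto)
qed

text \<open>Distributing \<open>(p \<oplus> a)(q \<oplus> b)\<close> leaves three summands with a factor in \<open>P\<close> and one in
  \<open>A \<inter> B\<close>. This is the form in which distributivity of the lattice of hyperideals enters.\<close>

lemma mult_set_hadd_in_hyperideal: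
  assumes P: "hyperideal P" and A: "hyperideal A" and B: "hyperideal B" and AB: "A \<inter> B \<subseteq> P"
    and y: "y \<in> set_hadd hadd P A" and z: "z \<in> set_hadd hadd P B"
  shows "mult y z \<in> P"
proof -
  obtain p a where p: "p \<in> P" "a \<in> A" "y \<in> hadd p a" using y by (auto simp: set_hadd_def)
  obtain q b where q: "q \<in> P" "b \<in> B" "z \<in> hadd q b" using z by (auto simp: set_hadd_def)
  have "mult a b \<in> P" using AB hyperidealD(3)[OF A p(2)] hyperidealD(2)[OF B q(2)] by blast
  hence "mult a z \<in> P"
    using hyperidealD(1)[OF P hyperidealD(2)[OF P q(1)] _ mult_hadd_left[OF q(3)]] by blast
  thus ?thesis
    using hyperidealD(1)[OF P hyperidealD(3)[OF P p(1)] _ mult_hadd_right[OF p(3)]] by blast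
qed

text \<open>If neither \<open>A\<close> nor \<open>B\<close> lies in \<open>P\<close>, maximality puts \<open>x\<close> in both \<open>P \<oplus> A\<close> and \<open>P \<oplus> B\<close>.
  Idempotency of the intersection \<open>C\<close> of these two turns this into a representation of \<open>x\<close> by
  products \<open>y z\<close> with \<open>y, z \<in> C\<close>; reading \<open>y\<close> as an element of the first and \<open>z\<close> of the second
  puts every product, and so \<open>x\<close>, in \<open>P\<close>.\<close>

lemma maximal_avoiding_is_prime:
  assumes fi: fully_idempotent and P: "hyperideal P" "x \<notin> P"
    and max: "\<And>Q. hyperideal Q \<Longrightarrow> P \<subseteq> Q \<Longrightarrow> x \<notin> Q \<Longrightarrow> Q = P"
    and A: "hyperideal A" and B: "hyperideal B" and AB: "A \<inter> B \<subseteq> P"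
  shows "A \<subseteq> P \<or> B \<subseteq> P"
proof (rule ccontr)
  assume neg: "\<not> ?thesis"
  have above: "x \<in> set_hadd hadd P I" if "hyperideal I" "\<not> I \<subseteq> P" for I
    using max[OF hyperideal_set_hadd[OF P(1) that(1)]] set_hadd_upper[OF P(1) that(1)] that(2)
    by blast
  let ?C = "set_hadd hadd P A \<inter> set_hadd hadd P B"
  have "x \<in> ?C" using above A B neg by blast
  moreover have "hyperideal ?C"
    by (intro hyperideal_Int hyperideal_set_hadd P A B)
  ultimately have "x \<in> hyperideal_prod ?C ?C"
    using fi by (simp add: fully_idempotent_def)
  then obtain ps where ps: "set ps \<subseteq> ?C \<times> ?C" "x \<in> hypersum (map (\<lambda>(a, b). mult a b) ps)"
    by (auto simp: hyperideal_prod_def)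
  have "set (map (\<lambda>(a, b). mult a b) ps) \<subseteq> P"
    using ps(1) mult_set_hadd_in_hyperideal[OF P(1) A B AB] by auto
  from hypersum_subset_hyperideal[OF P(1) this] ps(2) P(2) show False by blast
qed

section \<open>Fuzzy hyperideals and their lattice\<close>

lemma fuzzy_hyperideal_iff:
  "fuzzy_hyperideal \<mu> \<longleftrightarrow> (\<forall>x. 0 \<le> \<mu> x \<and> \<mu> x \<le> 1) \<and> \<mu> zero = 1 \<and>
     (\<forall>x y. \<forall>z\<in>hadd x y. min (\<mu> x) (\<mu> y) \<le> \<mu> z) \<and>
     (\<forall>x y. \<mu> x \<le> \<mu> (mult x y) \<and> \<mu> x \<le> \<mu> (mult y x))"
proof -
  have "min (\<mu> x) (\<mu> y) \<le> (INF z\<in>hadd x y. \<mu> z) \<longleftrightarrow> (\<forall>z\<in>hadd x y. min (\<mu> x) (\<mu> y) \<le> \<mu> z)"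
    if "\<forall>x. 0 \<le> \<mu> x" for x y
  proof (rule le_cINF_iff[OF hadd_nonempty])
    show "bdd_below (\<mu> ` hadd x y)" using that by (auto intro: bdd_belowI)
  qed
  thus ?thesis unfolding fuzzy_hyperideal_def fuzzy_subset_def by auto
qed

lemma fuzzy_hyperidealD:
  assumes "fuzzy_hyperideal \<mu>"
  shows "0 \<le> \<mu> x" "\<mu> x \<le> 1" "\<mu> zero = 1" "z \<in> hadd x y \<Longrightarrow> min (\<mu> x) (\<mu> y) \<le> \<mu> z"
    "\<mu> x \<le> \<mu> (mult x y)" "\<mu> x \<le> \<mu> (mult y x)"
  using assms by (auto simp: fuzzy_hyperideal_iff)

lemma hyperideal_level_ge:
  assumes "fuzzy_hyperideal \<mu>" "t \<le> 1"
  shows "hyperideal {x. t \<le> \<mu> x}"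
proof -
  have "t \<le> \<mu> zero" using assms(2) fuzzy_hyperidealD(3)[OF assms(1)] by simp
  moreover have "t \<le> \<mu> z" if "t \<le> \<mu> x" "t \<le> \<mu> y" "z \<in> hadd x y" for x y z
    using that(1,2) fuzzy_hyperidealD(4)[OF assms(1) that(3)] by linarith
  moreover have "t \<le> \<mu> (mult r x) \<and> t \<le> \<mu> (mult x r)" if "t \<le> \<mu> x" for r x
    using that fuzzy_hyperidealD(5,6)[OF assms(1), of x r] by linarith
  ultimately show ?thesis unfolding hyperideal_def by blast
qed

lemma hyperideal_level_greater:
  assumes "fuzzy_hyperideal \<mu>" "t < 1"
  shows "hyperideal {x. t < \<mu> x}"
proof -
  have "t < \<mu> zero" using assms(2) fuzzy_hyperidealD(3)[OF assms(1)] by simp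
  moreover have "t < \<mu> z" if "t < \<mu> x" "t < \<mu> y" "z \<in> hadd x y" for x y z
    using that(1,2) fuzzy_hyperidealD(4)[OF assms(1) that(3)] by linarith
  moreover have "t < \<mu> (mult r x) \<and> t < \<mu> (mult x r)" if "t < \<mu> x" for r x
    using that fuzzy_hyperidealD(5,6)[OF assms(1), of x r] by linarith
  ultimately show ?thesis unfolding hyperideal_def by blast
qed

lemma fuzzy_hyperideal_one: "fuzzy_hyperideal (\<lambda>x. 1)"
  by (simp add: fuzzy_hyperideal_iff)

lemma fuzzy_hyperideal_INF:
  assumes "F \<noteq> {}" "\<And>\<mu>. \<mu> \<in> F \<Longrightarrow> fuzzy_hyperideal \<mu>"
  shows "fuzzy_hyperideal (\<lambda>x. INF \<mu>\<in>F. \<mu> x)"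
proof -
  note F = fuzzy_hyperidealD[OF assms(2)]
  have bdd: "bdd_below ((\<lambda>\<mu>. \<mu> x) ` F)" for x
    using F(1) by (auto intro!: bdd_belowI[of _ 0])
  have lower: "(INF \<mu>\<in>F. \<mu> x) \<le> \<mu> x" if "\<mu> \<in> F" for \<mu> x
    using bdd that by (rule cINF_lower)
  note greatest = cINF_greatest[OF assms(1)]
  show ?thesis unfolding fuzzy_hyperideal_iff
  proof (intro conjI allI ballI)
    fix x show "0 \<le> (INF \<mu>\<in>F. \<mu> x)" using F(1) by (rule greatest)
    show "(INF \<mu>\<in>F. \<mu> x) \<le> 1"
      using assms(1) F(2) lower by (meson all_not_in_conv order_trans)
  next
    have "(INF \<mu>\<in>F. \<mu> zero) = (INF \<mu>\<in>F. 1)" using F(3) by (intro INF_cong) auto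
    thus "(INF \<mu>\<in>F. \<mu> zero) = 1" using assms(1) by simp
  next
    fix x y z assume z: "z \<in> hadd x y"
    show "min (INF \<mu>\<in>F. \<mu> x) (INF \<mu>\<in>F. \<mu> y) \<le> (INF \<mu>\<in>F. \<mu> z)"
    proof (rule greatest)
      fix \<mu> assume "\<mu> \<in> F"
      thus "min (INF \<mu>\<in>F. \<mu> x) (INF \<mu>\<in>F. \<mu> y) \<le> \<mu> z"
        using F(4)[OF _ z, of \<mu>] lower[of \<mu> x] lower[of \<mu> y] by linarith
    qed
  next
    fix x y
    show "(INF \<mu>\<in>F. \<mu> x) \<le> (INF \<mu>\<in>F. \<mu> (mult x y))" "(INF \<mu>\<in>F. \<mu> x) \<le> (INF \<mu>\<in>F. \<mu> (mult y x))"
      using F(5,6) lower by (blast intro: greatest order_trans)+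
  qed
qed

lemma fuzzy_hyperideal_inf:
  assumes "fuzzy_hyperideal \<kappa>" "fuzzy_hyperideal \<mu>"
  shows "fuzzy_hyperideal (inf \<kappa> \<mu>)"
proof -
  have "(\<lambda>x. INF \<nu>\<in>{\<kappa>, \<mu>}. \<nu> x) = inf \<kappa> \<mu>" by (auto simp: fun_eq_iff cInf_insert_If)
  with fuzzy_hyperideal_INF[of "{\<kappa>, \<mu>}"] assms show ?thesis by auto
qed

text \<open>The least upper bound is the pointwise infimum of all upper bounds, of which the constant
  \<open>1\<close> is always one. Describing it by its universal property avoids a formula for infinite sums.\<close>

lemma fuzzy_hyperideal_lub_exists:
  assumes "\<And>\<mu>. \<mu> \<in> F \<Longrightarrow> fuzzy_hyperideal \<mu>"
  obtains \<sigma> where "fuzzy_hyperideal \<sigma>"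
    "\<And>\<eta>. fuzzy_hyperideal \<eta> \<Longrightarrow> \<sigma> \<le> \<eta> \<longleftrightarrow> (\<forall>\<mu>\<in>F. \<mu> \<le> \<eta>)"
proof -
  let ?U = "{\<eta>. fuzzy_hyperideal \<eta> \<and> (\<forall>\<mu>\<in>F. \<mu> \<le> \<eta>)}"
  let ?\<sigma> = "\<lambda>x. INF \<eta>\<in>?U. \<eta> x"
  have ne: "?U \<noteq> {}"
    using fuzzy_hyperideal_one fuzzy_hyperidealD(2)[OF assms] by (auto simp: le_fun_def)
  have bdd: "bdd_below ((\<lambda>\<eta>. \<eta> x) ` ?U)" for x
    using fuzzy_hyperidealD(1) by (auto intro!: bdd_belowI[of _ 0])
  have "?\<sigma> \<le> \<eta>" if "\<eta> \<in> ?U" for \<eta>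
    using cINF_lower[OF bdd that] by (rule le_funI)
  moreover have "\<mu> \<le> ?\<sigma>" if "\<mu> \<in> F" for \<mu>
    using that by (intro le_funI cINF_greatest[OF ne]) (auto simp: le_fun_def)
  ultimately have "?\<sigma> \<le> \<eta> \<longleftrightarrow> (\<forall>\<mu>\<in>F. \<mu> \<le> \<eta>)" if "fuzzy_hyperideal \<eta>" for \<eta>
    using that by (blast intro: order_trans)
  with that[of ?\<sigma>] fuzzy_hyperideal_INF[OF ne] show thesis by blast
qed

lemma fuzzy_sum_upper:
  assumes "fuzzy_hyperideal \<kappa>" "fuzzy_hyperideal \<mu>" "x \<in> hadd y z"
  shows "min (\<kappa> y) (\<mu> z) \<le> fuzzy_sum \<kappa> \<mu> x"
  unfolding fuzzy_sum_def using assms fuzzy_hyperidealD(2)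
  by (intro fuzzy_Sup_upper) (auto simp: min_le_iff_disj)

lemma fuzzy_hyperideal_sum:
  assumes \<kappa>: "fuzzy_hyperideal \<kappa>" and \<mu>: "fuzzy_hyperideal \<mu>"
  shows "fuzzy_hyperideal (fuzzy_sum \<kappa> \<mu>)"
  unfolding fuzzy_hyperideal_iff
proof (intro conjI allI ballI)
  note K = fuzzy_hyperidealD[OF \<kappa>] and M = fuzzy_hyperidealD[OF \<mu>]
  note upper = fuzzy_sum_upper[OF \<kappa> \<mu>]
  have ne: "{min (\<kappa> y) (\<mu> z) |y z. x \<in> hadd y z} \<noteq> {}" for x
    using hadd_zero_right[of x] by auto
  have nonneg: "0 \<le> fuzzy_sum \<kappa> \<mu> x" for x
    using upper[of x x zero] hadd_zero_right[of x] K(1)[of x] M(3) by simp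
  have le1: "fuzzy_sum \<kappa> \<mu> x \<le> 1" for x
    unfolding fuzzy_sum_def using K(2) by (intro fuzzy_Sup_least) (auto simp: min_le_iff_disj)
  show "0 \<le> fuzzy_sum \<kappa> \<mu> x" "fuzzy_sum \<kappa> \<mu> x \<le> 1" for x
    by (fact nonneg le1)+
  have "1 \<le> fuzzy_sum \<kappa> \<mu> zero"
    using upper[of zero zero zero] hadd_zero_right[of zero] K(3) M(3) by simp
  thus "fuzzy_sum \<kappa> \<mu> zero = 1" using le1[of zero] by simp
  show "min (fuzzy_sum \<kappa> \<mu> x) (fuzzy_sum \<kappa> \<mu> y) \<le> fuzzy_sum \<kappa> \<mu> w" if w: "w \<in> hadd x y" for x y w
    unfolding fuzzy_sum_def[of \<kappa> \<mu> x] fuzzy_sum_def[of \<kappa> \<mu> y]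
  proof (rule min_fuzzy_Sup_le[OF ne ne], clarify)
    fix a b c d assume "x \<in> hadd a b" "y \<in> hadd c d"
    with w obtain u v where uv: "u \<in> hadd a c" "v \<in> hadd b d" "w \<in> hadd u v"
      using hadd_interchange by blast
    show "min (min (\<kappa> a) (\<mu> b)) (min (\<kappa> c) (\<mu> d)) \<le> fuzzy_sum \<kappa> \<mu> w"
      using K(4)[OF uv(1)] M(4)[OF uv(2)] upper[OF uv(3)] by linarith
  qed
  fix x y
  show "fuzzy_sum \<kappa> \<mu> x \<le> fuzzy_sum \<kappa> \<mu> (mult x y)"
    unfolding fuzzy_sum_def[of \<kappa> \<mu> x]
  proof (rule fuzzy_Sup_least[OF _ nonneg], clarify)
    fix a b assume "x \<in> hadd a b"
    from upper[OF mult_hadd_right[OF this]] K(5)[of a y] M(5)[of b y]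
    show "min (\<kappa> a) (\<mu> b) \<le> fuzzy_sum \<kappa> \<mu> (mult x y)" by (meson min.mono order_trans)
  qed
  show "fuzzy_sum \<kappa> \<mu> x \<le> fuzzy_sum \<kappa> \<mu> (mult y x)"
    unfolding fuzzy_sum_def[of \<kappa> \<mu> x]
  proof (rule fuzzy_Sup_least[OF _ nonneg], clarify)
    fix a b assume "x \<in> hadd a b"
    from upper[OF mult_hadd_left[OF this]] K(6)[of a y] M(6)[of b y]
    show "min (\<kappa> a) (\<mu> b) \<le> fuzzy_sum \<kappa> \<mu> (mult y x)" by (meson min.mono order_trans)
  qed
qed

lemma fuzzy_sum_le_iff:
  assumes \<kappa>: "fuzzy_hyperideal \<kappa>" and \<mu>: "fuzzy_hyperideal \<mu>" and \<eta>: "fuzzy_hyperideal \<eta>"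
  shows "fuzzy_sum \<kappa> \<mu> \<le> \<eta> \<longleftrightarrow> \<kappa> \<le> \<eta> \<and> \<mu> \<le> \<eta>"
proof
  note upper = fuzzy_sum_upper[OF \<kappa> \<mu>]
  have "\<kappa> x \<le> fuzzy_sum \<kappa> \<mu> x" "\<mu> x \<le> fuzzy_sum \<kappa> \<mu> x" for x
    using upper[of x x zero] upper[of x zero x] hadd_zero_left[of x] hadd_zero_right[of x]
      fuzzy_hyperidealD(2,3)[OF \<kappa>] fuzzy_hyperidealD(2,3)[OF \<mu>]
    by (simp_all add: min_absorb1 min_absorb2)
  hence "\<kappa> \<le> fuzzy_sum \<kappa> \<mu>" "\<mu> \<le> fuzzy_sum \<kappa> \<mu>" by (simp_all add: le_fun_def)
  thus "\<kappa> \<le> \<eta> \<and> \<mu> \<le> \<eta>" if "fuzzy_sum \<kappa> \<mu> \<le> \<eta>" using that by (blast intro: order_trans)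
next
  assume le: "\<kappa> \<le> \<eta> \<and> \<mu> \<le> \<eta>"
  show "fuzzy_sum \<kappa> \<mu> \<le> \<eta>"
    unfolding le_fun_def fuzzy_sum_def
  proof (intro allI fuzzy_Sup_least[OF _ fuzzy_hyperidealD(1)[OF \<eta>]], clarify)
    fix x y z assume "x \<in> hadd y z"
    from fuzzy_hyperidealD(4)[OF \<eta> this] le show "min (\<kappa> y) (\<mu> z) \<le> \<eta> x"
      unfolding le_fun_def by (meson min.mono order_trans)
  qed
qed

lemma FI_lattice_operations:
  shows "lattice FI_lattice"
    and "\<kappa> \<in> FI \<Longrightarrow> \<mu> \<in> FI \<Longrightarrow> join FI_lattice \<kappa> \<mu> = fuzzy_sum \<kappa> \<mu>"
    and "\<kappa> \<in> FI \<Longrightarrow> \<mu> \<in> FI \<Longrightarrow> meet FI_lattice \<kappa> \<mu> = inf \<kappa> \<mu>"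
proof -
  have s: "fuzzy_sum \<kappa> \<mu> \<in> FI \<and> \<kappa> \<le> fuzzy_sum \<kappa> \<mu> \<and> \<mu> \<le> fuzzy_sum \<kappa> \<mu>"
    if "\<kappa> \<in> FI" "\<mu> \<in> FI" for \<kappa> \<mu>
    using that fuzzy_hyperideal_sum[of \<kappa> \<mu>] fuzzy_sum_le_iff[of \<kappa> \<mu> "fuzzy_sum \<kappa> \<mu>"]
    by (simp add: FI_def)
  have l: "fuzzy_sum \<kappa> \<mu> \<le> \<eta>" if "\<kappa> \<in> FI" "\<mu> \<in> FI" "\<eta> \<in> FI" "\<kappa> \<le> \<eta>" "\<mu> \<le> \<eta>" for \<kappa> \<mu> \<eta>
    using that fuzzy_sum_le_iff by (simp add: FI_def)
  have i: "inf \<kappa> \<mu> \<in> FI \<and> inf \<kappa> \<mu> \<le> \<kappa> \<and> inf \<kappa> \<mu> \<le> \<mu>" if "\<kappa> \<in> FI" "\<mu> \<in> FI" for \<kappa> \<mu>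
    using that fuzzy_hyperideal_inf by (simp add: FI_def)
  note ops = order_gorder_lattice[OF s l i, folded FI_lattice_def]
  show "lattice FI_lattice" by (rule ops) auto
  show "join FI_lattice \<kappa> \<mu> = fuzzy_sum \<kappa> \<mu>" if "\<kappa> \<in> FI" "\<mu> \<in> FI"
    using that by (intro ops) auto
  show "meet FI_lattice \<kappa> \<mu> = inf \<kappa> \<mu>" if "\<kappa> \<in> FI" "\<mu> \<in> FI"
    using that by (intro ops) auto
qed

section \<open>Products are meets, and fuzzy primes separate\<close>

text \<open>Both inequalities compare level sets. Take a representation of \<open>x\<close> by products \<open>y z\<close> and let
  \<open>t\<close> be the minimum of its membership values: each product, and hence \<open>x\<close>, lies in the hyperideal
  \<open>{\<kappa> \<ge> t} \<inter> {\<mu> \<ge> t}\<close>. Conversely \<open>x\<close> lies in this hyperideal for \<open>t = \<kappa> x \<and> \<mu> x\<close>, and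
  idempotency supplies a representation whose values are all at least \<open>t\<close>.\<close>

lemma fuzzy_prod_eq_inf:
  assumes fi: fully_idempotent and \<kappa>: "fuzzy_hyperideal \<kappa>" and \<mu>: "fuzzy_hyperideal \<mu>"
  shows "fuzzy_prod \<kappa> \<mu> = inf \<kappa> \<mu>"
proof (rule antisym)
  let ?m = "\<lambda>ps. Min ((\<lambda>(y, z). min (\<kappa> y) (\<mu> z)) ` set ps)"
  note K = fuzzy_hyperidealD[OF \<kappa>] and M = fuzzy_hyperidealD[OF \<mu>]
  show "fuzzy_prod \<kappa> \<mu> \<le> inf \<kappa> \<mu>"
    unfolding le_fun_def fuzzy_prod_def
  proof (intro allI fuzzy_Sup_least, clarify)
    fix x ps assume ps: "ps \<noteq> []" and x: "x \<in> hypersum (map (\<lambda>(y, z). mult y z) ps)"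
    have m: "?m ps \<le> \<kappa> y" "?m ps \<le> \<mu> z" if "(y, z) \<in> set ps" for y z
    proof -
      have "?m ps \<le> min (\<kappa> y) (\<mu> z)" by (rule Min_le) (use that in \<open>auto intro: rev_image_eqI\<close>)
      thus "?m ps \<le> \<kappa> y" "?m ps \<le> \<mu> z" by simp_all
    qed
    have le1: "?m ps \<le> 1" using ps m(1) K(2)
      by (metis list.set_intros(1) neq_Nil_conv order_trans surj_pair)
    let ?I = "{x. ?m ps \<le> \<kappa> x} \<inter> {x. ?m ps \<le> \<mu> x}"
    have "set (map (\<lambda>(y, z). mult y z) ps) \<subseteq> ?I"
      using m by (auto intro: order_trans[OF _ K(5)] order_trans[OF _ M(6)])
    with x have "x \<in> ?I"
      using hypersum_subset_hyperideal hyperideal_Int hyperideal_level_ge \<kappa> \<mu> le1 by blast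
    thus "?m ps \<le> inf \<kappa> \<mu> x" by simp
  qed (use K(1) M(1) in simp)
  show "inf \<kappa> \<mu> \<le> fuzzy_prod \<kappa> \<mu>"
    unfolding le_fun_def
  proof
    fix x
    let ?t = "min (\<kappa> x) (\<mu> x)"
    let ?I = "{x. ?t \<le> \<kappa> x} \<inter> {x. ?t \<le> \<mu> x}"
    have "?t \<le> 1" using K(2)[of x] by simp
    hence "hyperideal ?I" by (intro hyperideal_Int hyperideal_level_ge \<kappa> \<mu>)
    hence "x \<in> hyperideal_prod ?I ?I" using fi by (simp add: fully_idempotent_def)
    then obtain ps where ps: "ps \<noteq> []" "set ps \<subseteq> ?I \<times> ?I"
      "x \<in> hypersum (map (\<lambda>(a, b). mult a b) ps)"
      by (auto simp: hyperideal_prod_def)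
    have "?t \<le> ?m ps" using ps(1,2) by (subst Min_ge_iff) auto
    also have "?m ps \<le> fuzzy_prod \<kappa> \<mu> x"
      unfolding fuzzy_prod_def
    proof (rule fuzzy_Sup_upper)
      show "?m ps \<in> {?m ps |ps. ps \<noteq> [] \<and> x \<in> hypersum (map (\<lambda>(y, z). mult y z) ps)}"
        using ps by blast
      fix w assume "w \<in> {?m ps |ps. ps \<noteq> [] \<and> x \<in> hypersum (map (\<lambda>(y, z). mult y z) ps)}"
      then obtain qs where qs: "qs \<noteq> []" "w = ?m qs" by blast
      hence "w \<in> (\<lambda>(y, z). min (\<kappa> y) (\<mu> z)) ` set qs" by (simp add: Min_in)
      thus "w \<le> 1" using K(2) by (auto simp: min_le_iff_disj)
    qed
    finally show "inf \<kappa> \<mu> x \<le> fuzzy_prod \<kappa> \<mu> x" by (simp add: inf_min)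
  qed
qed

lemma fuzzy_hyperideal_two_valued:
  assumes "hyperideal P" "0 \<le> \<alpha>" "\<alpha> \<le> 1"
  shows "fuzzy_hyperideal (\<lambda>y. if y \<in> P then 1 else \<alpha>)"
  unfolding fuzzy_hyperideal_iff
  using assms(2,3) zero_in_hyperideal[OF assms(1)]
  by (auto intro: hyperidealD[OF assms(1)])

text \<open>The level of the separating fuzzy prime off \<open>P\<close> is \<open>\<kappa> x\<close> itself. Since
  \<open>P\<close> contains the strict level set \<open>{\<kappa> > \<kappa> x}\<close>, this is high enough to dominate \<open>\<kappa>\<close>, and it is
  attained at \<open>x\<close>. Fuzzy primeness follows by passing to strict level sets at the same level, where
  the condition becomes primeness of \<open>P\<close>.\<close>

lemma fuzzy_prime_separation:
  assumes fi: fully_idempotent and \<kappa>: "fuzzy_hyperideal \<kappa>" and less1: "\<kappa> x < 1"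
  obtains \<eta> where "\<eta> \<in> FP" "\<kappa> \<le> \<eta>" "\<eta> x = \<kappa> x"
proof -
  let ?\<alpha> = "\<kappa> x"
  obtain P where P: "hyperideal P" "{y. ?\<alpha> < \<kappa> y} \<subseteq> P" "x \<notin> P"
    and max: "\<And>Q. hyperideal Q \<Longrightarrow> P \<subseteq> Q \<Longrightarrow> x \<notin> Q \<Longrightarrow> Q = P"
    using exists_maximal_hyperideal_avoiding[OF hyperideal_level_greater[OF \<kappa> less1], of x] by auto
  define \<eta> where "\<eta> = (\<lambda>y. if y \<in> P then 1 else ?\<alpha>)"
  have \<eta>: "fuzzy_hyperideal \<eta>"
    unfolding \<eta>_def using P(1) fuzzy_hyperidealD(1,2)[OF \<kappa>] by (rule fuzzy_hyperideal_two_valued)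
  have "fuzzy_prime \<eta>"
    unfolding fuzzy_prime_def
  proof (intro conjI allI impI \<eta>)
    fix \<mu> \<nu> assume \<mu>: "fuzzy_hyperideal \<mu>" and \<nu>: "fuzzy_hyperideal \<nu>" and "fuzzy_prod \<mu> \<nu> \<le> \<eta>"
    hence le: "min (\<mu> z) (\<nu> z) \<le> \<eta> z" for z
      using fuzzy_prod_eq_inf[OF fi \<mu> \<nu>] by (auto simp: le_fun_def inf_min)
    let ?A = "{z. ?\<alpha> < \<mu> z}" and ?B = "{z. ?\<alpha> < \<nu> z}"
    have "?A \<inter> ?B \<subseteq> P"
    proof
      fix z assume "z \<in> ?A \<inter> ?B"
      with le[of z] show "z \<in> P" by (auto simp: \<eta>_def split: if_splits)
    qed
    from maximal_avoiding_is_prime[OF fi P(1,3) max hyperideal_level_greater[OF \<mu> less1]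
        hyperideal_level_greater[OF \<nu> less1] this]
    have "?A \<subseteq> P \<or> ?B \<subseteq> P" .
    moreover have "\<rho> \<le> \<eta>" if "fuzzy_hyperideal \<rho>" "{z. ?\<alpha> < \<rho> z} \<subseteq> P" for \<rho>
      using that(2) fuzzy_hyperidealD(2)[OF that(1)] by (auto simp: le_fun_def \<eta>_def intro: leI)
    ultimately show "\<mu> \<le> \<eta> \<or> \<nu> \<le> \<eta>" using \<mu> \<nu> by metis
  qed
  moreover have eq: "\<eta> x = \<kappa> x" using P(3) by (simp add: \<eta>_def)
  ultimately have "\<eta> \<in> FP" using less1 by (auto simp: FP_def)
  moreover have "\<kappa> \<le> \<eta>"
    using P(2) fuzzy_hyperidealD(2)[OF \<kappa>] by (auto simp: le_fun_def \<eta>_def intro: leI)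
  ultimately show thesis using eq by (rule that)
qed

section \<open>The topology on the set of fuzzy primes\<close>

lemma FP_fuzzy_hyperideal: "\<eta> \<in> FP \<Longrightarrow> fuzzy_hyperideal \<eta>"
  by (simp add: FP_def fuzzy_prime_def)

lemma FP_open_one: "FP_open (\<lambda>x. 1) = FP"
proof -
  have "\<not> (\<lambda>x. 1) \<le> \<eta>" if "\<eta> \<in> FP" for \<eta>
    using that fuzzy_hyperidealD(2)[OF FP_fuzzy_hyperideal[OF that]]
    by (auto simp: FP_def le_fun_def intro: antisym)
  thus ?thesis by (auto simp: FP_open_def)
qed

lemma FP_open_inf:
  assumes fully_idempotent "fuzzy_hyperideal \<kappa>" "fuzzy_hyperideal \<mu>"
  shows "FP_open (inf \<kappa> \<mu>) = FP_open \<kappa> \<inter> FP_open \<mu>"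
proof -
  have "inf \<kappa> \<mu> \<le> \<eta> \<longleftrightarrow> \<kappa> \<le> \<eta> \<or> \<mu> \<le> \<eta>" if "\<eta> \<in> FP" for \<eta>
    using that assms fuzzy_prod_eq_inf[OF assms]
    by (metis (mono_tags, lifting) FP_def fuzzy_prime_def le_infI1 le_infI2 mem_Collect_eq)
  thus ?thesis by (auto simp: FP_open_def)
qed

lemma FP_open_fuzzy_sum:
  assumes "fuzzy_hyperideal \<kappa>" "fuzzy_hyperideal \<mu>"
  shows "FP_open (fuzzy_sum \<kappa> \<mu>) = FP_open \<kappa> \<union> FP_open \<mu>"
  using fuzzy_sum_le_iff[OF assms FP_fuzzy_hyperideal] by (auto simp: FP_open_def)

text \<open>The set \<open>O_\<kappa>\<close> determines which proper fuzzy primes lie above \<open>\<kappa>\<close>, and by separation these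
  determine \<open>\<kappa>\<close> at every point where its value is below \<open>1\<close>.\<close>

lemma FP_open_inj:
  assumes fi: fully_idempotent
  shows "inj_on FP_open FI"
proof -
  have le: "\<kappa> \<le> \<mu>"
    if \<kappa>: "fuzzy_hyperideal \<kappa>" and \<mu>: "fuzzy_hyperideal \<mu>" and eq: "FP_open \<kappa> = FP_open \<mu>"
    for \<kappa> \<mu>
    unfolding le_fun_def
  proof (rule allI, rule ccontr)
    fix x assume less: "\<not> \<kappa> x \<le> \<mu> x"
    with fuzzy_hyperidealD(2)[OF \<kappa>, of x] have "\<mu> x < 1" by linarith
    then obtain \<eta> where "\<eta> \<in> FP" "\<mu> \<le> \<eta>" "\<eta> x = \<mu> x"
      using fuzzy_prime_separation[OF fi \<mu>] by blast
    moreover from this eq have "\<kappa> \<le> \<eta>" by (auto simp: FP_open_def)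
    ultimately show False using less by (metis le_funD)
  qed
  show ?thesis
    by (rule inj_onI) (auto simp: FI_def intro: antisym le)
qed

lemma istopology_FP_opens:
  assumes fi: fully_idempotent
  shows "istopology (\<lambda>U. U \<in> FP_opens)"
  unfolding istopology_def
proof (intro conjI allI impI)
  fix U V assume "U \<in> FP_opens" "V \<in> FP_opens"
  then obtain \<kappa> \<mu> where "fuzzy_hyperideal \<kappa>" "fuzzy_hyperideal \<mu>" "U = FP_open \<kappa>" "V = FP_open \<mu>"
    by (auto simp: FP_opens_def FI_def)
  with FP_open_inf[OF fi] fuzzy_hyperideal_inf show "U \<inter> V \<in> FP_opens"
    unfolding FP_opens_def FI_def by (metis image_eqI mem_Collect_eq)
next
  fix \<U> assume "\<forall>U\<in>\<U>. U \<in> FP_opens"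
  hence "\<U> \<subseteq> FP_open ` FI" by (auto simp: FP_opens_def)
  then obtain F where F: "F \<subseteq> FI" "\<U> = FP_open ` F" by (auto simp: subset_image_iff)
  obtain \<sigma> where \<sigma>: "fuzzy_hyperideal \<sigma>"
    "\<And>\<eta>. fuzzy_hyperideal \<eta> \<Longrightarrow> \<sigma> \<le> \<eta> \<longleftrightarrow> (\<forall>\<mu>\<in>F. \<mu> \<le> \<eta>)"
    by (rule fuzzy_hyperideal_lub_exists[of F]) (use F(1) in \<open>auto simp: FI_def\<close>)
  have "\<Union>\<U> = FP_open \<sigma>"
    using \<sigma>(2)[OF FP_fuzzy_hyperideal] by (auto simp: F(2) FP_open_def)
  thus "\<Union>\<U> \<in> FP_opens" using \<sigma>(1) by (simp add: FP_opens_def FI_def)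
qed

lemma topspace_FP_opens:
  assumes fully_idempotent
  shows "topspace (topology (\<lambda>U. U \<in> FP_opens)) = FP"
proof -
  have "FP \<in> FP_opens"
    using FP_open_one fuzzy_hyperideal_one by (auto simp: FP_opens_def FI_def intro!: rev_image_eqI)
  moreover have "U \<subseteq> FP" if "U \<in> FP_opens" for U
    using that by (auto simp: FP_opens_def FP_open_def)
  ultimately show ?thesis
    using topology_inverse'[OF istopology_FP_opens[OF assms]] by (auto simp: topspace_def)
qed

lemma lattice_iso_FP_open:
  assumes fi: fully_idempotent
  shows "lattice_iso FP_open FI_lattice (opens_lattice (topology (\<lambda>U. U \<in> FP_opens)))"
proof -
  have openin: "openin (topology (\<lambda>U. U \<in> FP_opens)) = (\<lambda>U. U \<in> FP_opens)"
    by (rule topology_inverse'[OF istopology_FP_opens[OF fi]])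
  have carr: "carrier FI_lattice = FI" by (simp add: FI_lattice_def)
  have mem: "FP_open \<kappa> \<in> FP_opens" if "\<kappa> \<in> FI" for \<kappa>
    using that by (simp add: FP_opens_def)
  have "bij_betw FP_open FI (carrier (opens_lattice (topology (\<lambda>U. U \<in> FP_opens))))"
    using FP_open_inj[OF fi]
    by (simp add: bij_betw_def opens_lattice_def openin) (simp add: FP_opens_def)
  thus ?thesis
    unfolding lattice_iso_def carr
    using FP_open_fuzzy_sum FP_open_inf[OF fi]
    by (simp add: FI_lattice_operations opens_lattice_operations openin mem) (simp add: FI_def)
qed

end

theorem theorem4p1:
  fixes hadd :: "'a \<Rightarrow> 'a \<Rightarrow> 'a set" and mult :: "'a \<Rightarrow> 'a \<Rightarrow> 'a" and zero :: 'a
  assumes "semihyperring hadd mult zero"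
    and "semihyperring.fully_idempotent hadd mult zero"
  defines "FI \<equiv> semihyperring.FI hadd mult zero"
    and "FP \<equiv> semihyperring.FP hadd mult zero"
    and "\<O> \<equiv> semihyperring.FP_open hadd mult zero"
    and "\<tau> \<equiv> semihyperring.FP_opens hadd mult zero"
    and "L \<equiv> semihyperring.FI_lattice hadd mult zero"
  shows "istopology (\<lambda>U. U \<in> \<tau>) \<and> topspace (topology (\<lambda>U. U \<in> \<tau>)) = FP \<and>
    (\<forall>\<kappa>\<in>FI. \<forall>\<mu>\<in>FI. join L \<kappa> \<mu> = semihyperring.fuzzy_sum hadd \<kappa> \<mu> \<and> meet L \<kappa> \<mu> = inf \<kappa> \<mu>) \<and>
    lattice_iso \<O> L (opens_lattice (topology (\<lambda>U. U \<in> \<tau>)))"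
proof -
  interpret semihyperring hadd mult zero by (fact assms(1))
  show ?thesis
    unfolding assms(3-)
    by (intro conjI ballI istopology_FP_opens topspace_FP_opens lattice_iso_FP_open
        FI_lattice_operations(2,3) assms(2))
qed

end
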